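(* Let $p,k\in\mathbb{R}$ with $pk>0$. Every straight line tangent to the parabola $\mathcal{P}'\colon z=p^2x^2+k^2$ cuts off from the parabola $\mathcal{P}\colon z=p^2x^2$ a parabolic segment of constant area, equal to $\frac{4}{3}\frac{k^3}{p}$. Conversely, let $f\in C^{2}(\mathbb{R})$ be a real-valued function such that $f(x)>p^2x^2$ for all $x\in\mathbb{R}$. If the tangent line to the curve $z=f(x)$ at each one of its points cuts off from the parabola $\mathcal{P}$ a segment of constant area $A$ (independent of the point), then $f(x)=p^2x^2+k^2$ for all $x\in\mathbb{R}$, where $k=\sqrt[3]{3pA/4}$.
   Context: $(x,z)$ are rectangular coordinates in the plane. The segment cut off from the parabola $z=p^2x^2$ by a line $z=mx+c$ meeting it in two points is the compact region $\{(x,z): p^2x^2\le z\le mx+c\}$. In the converse part, $p\neq 0$ is the fixed parameter of $\mathcal{P}$ and $k$ is defined from $A$ by the given formula (real cube root). *)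

theory Defs
  imports "HOL-Analysis.Analysis"
begin

definition parabola :: "real \<Rightarrow> (real \<times> real) set" where
  "parabola p = {(x, z). z = p\<^sup>2 * x\<^sup>2}"

definition line :: "real \<Rightarrow> real \<Rightarrow> (real \<times> real) set" where
  "line m c = {(x, z). z = m * x + c}"

definition segment :: "real \<Rightarrow> real \<Rightarrow> real \<Rightarrow> (real \<times> real) set" where
  "segment p m c = {(x, z). p\<^sup>2 * x\<^sup>2 \<le> z \<and> z \<le> m * x + c}"

definition cuts_off_area :: "real \<Rightarrow> real \<Rightarrow> real \<Rightarrow> real \<Rightarrow> bool" where
  "cuts_off_area p m c A \<longleftrightarrow>
     card (line m c \<inter> parabola p) = 2 \<and> measure lborel (segment p m c) = A"

(* The line z = m x + c is tangent to the curve z = f(x) at the point (a, f(a)).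
   Tangents to graphs of differentiable functions are never vertical, so the
   parameters m and c capture all of them. *)
definition tangent_at :: "(real \<Rightarrow> real) \<Rightarrow> real \<Rightarrow> real \<Rightarrow> real \<Rightarrow> bool" where
  "tangent_at f a m c \<longleftrightarrow> (a, f a) \<in> line m c \<and> (f has_real_derivative m) (at a)"

definition C2 :: "(real \<Rightarrow> real) \<Rightarrow> bool" where
  "C2 f \<longleftrightarrow> (\<exists>f' f''. (\<forall>x. (f has_real_derivative f' x) (at x)) \<and>
                    (\<forall>x. (f' has_real_derivative f'' x) (at x)) \<and>
                    continuous_on UNIV f'')"

end

theory Submission
  imports Defs
begin

text \<open>
  A line \<open>z = m x + c\<close> meets the parabola in two points iff \<open>D = m\<^sup>2 + 4 p\<^sup>2 c\<close> is positive, and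
  then it cuts off the area \<open>D\<^sup>3\<^sup>/\<^sup>2 / (6 p\<^sup>4)\<close>; so constant area means constant \<open>D\<close>. For the tangents
  of \<open>f\<close>, put \<open>g = f - p\<^sup>2 x\<^sup>2\<close>; constancy of \<open>D\<close> becomes the Clairaut-type equation
  \<open>g'\<^sup>2 + 4 p\<^sup>2 g = D\<close>. Differentiating gives \<open>g' (g'' + 2 p\<^sup>2) = 0\<close>, so
  \<open>(g'\<^sup>3)' = 3 g'\<^sup>2 g'' = - 6 p\<^sup>2 g'\<^sup>2 \<le> 0\<close> and \<open>g'\<close> is decreasing. A positive \<open>g\<close> with decreasing
  derivative is constant, whence \<open>g = D / (4 p\<^sup>2)\<close>.
\<close>

text \<open>The line is given by the abscissae \<open>r\<close>, \<open>s\<close> of its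
  intersections with the parabola; slope and intercept follow by Vieta. Over \<open>x\<close> the
  segment then has height \<open>p^2 * (x - r) * (s - x)\<close>, and by Fubini its area is the
  integral of this over \<open>{r..s}\<close>.\<close>

lemma measure_segment:
  fixes p r s :: real
  assumes "r \<le> s"
  shows "measure lborel (segment p (p\<^sup>2 * (r + s)) (- p\<^sup>2 * r * s)) = p\<^sup>2 * (s - r) ^ 3 / 6"
proof (cases "p = 0")
  case True
  have "segment 0 0 0 = UNIV \<times> {0::real}"
    by (auto simp: segment_def)
  moreover have "emeasure lborel (UNIV \<times> {0::real} :: (real \<times> real) set) = 0"
    unfolding lborel_prod[symmetric] by (subst lborel.emeasure_pair_measure_Times) auto
  ultimately show ?thesis
    using True by (simp add: measure_def)
next
  case False
  let ?S = "segment p (p\<^sup>2 * (r + s)) (- p\<^sup>2 * r * s)"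
  define h where "h x = p\<^sup>2 * ((x - r) * (s - x))" for x
  define H where "H x = p\<^sup>2 * ((r + s) * x\<^sup>2 / 2 - x ^ 3 / 3 - r * s * x)" for x
  have h: "p\<^sup>2 * (r + s) * x + - p\<^sup>2 * r * s - p\<^sup>2 * x\<^sup>2 = h x" for x
    unfolding h_def by (simp add: algebra_simps power2_eq_square)
  have h_nonneg: "0 \<le> h x" if "x \<in> {r..s}" for x
    using that unfolding h_def by simp
  have h_nonpos: "h x \<le> 0" if "x \<notin> {r..s}" for x
  proof -
    have "(x - r) * (s - x) \<le> 0"
      using that assms by (auto simp: mult_le_0_iff)
    then show ?thesis
      unfolding h_def by (simp add: mult_nonneg_nonpos)
  qed
  have "closed ?S"
    unfolding segment_def case_prod_unfold
    by (intro closed_Collect_conj closed_Collect_le continuous_intros)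
  then have S: "?S \<in> sets (lborel \<Otimes>\<^sub>M lborel)"
    unfolding lborel_prod by simp
  \<comment> \<open>Outside \<open>{r..s}\<close> the bound \<open>h x \<le> 0\<close> makes the
    fibre empty or a single point, so it contributes nothing.\<close>
  have fibre: "Pair x -` ?S = {p\<^sup>2 * x\<^sup>2 .. p\<^sup>2 * x\<^sup>2 + h x}" for x
    using h[of x] by (auto simp: segment_def)
  have "emeasure lborel ?S = (\<integral>\<^sup>+x. emeasure lborel (Pair x -` ?S) \<partial>lborel)"
    using lborel.emeasure_pair_measure_alt[OF S] by (simp add: lborel_prod)
  also have "\<dots> = (\<integral>\<^sup>+x. ennreal (h x) * indicator {r..s} x \<partial>lborel)"
  proof (intro nn_integral_cong)
    fix x :: real
    show "emeasure lborel (Pair x -` ?S) = ennreal (h x) * indicator {r..s} x"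
      unfolding fibre using h_nonneg[of x] h_nonpos[of x]
      by (cases "x \<in> {r..s}") (auto simp: emeasure_lborel_Icc_eq)
  qed
  also have "\<dots> = ennreal (H s - H r)"
  proof (rule nn_integral_FTC_Icc)
    show "h \<in> borel_measurable borel"
      unfolding h_def by measurable
    show "(H has_real_derivative h x) (at x)" for x
      unfolding H_def h_def
      by (auto intro!: derivative_eq_intros simp: field_simps power2_eq_square)
  qed (use assms h_nonneg in auto)
  also have "H s - H r = p\<^sup>2 * (s - r) ^ 3 / 6"
    unfolding H_def by (simp add: field_simps power2_eq_square power3_eq_cube)
  finally show ?thesis
    using assms by (simp add: measure_def)
qed

lemma card_line_Int_parabola:
  "card (line m c \<inter> parabola p) = card {x. p\<^sup>2 * x\<^sup>2 = m * x + c}"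
proof -
  have "line m c \<inter> parabola p = (\<lambda>x. (x, p\<^sup>2 * x\<^sup>2)) ` {x. p\<^sup>2 * x\<^sup>2 = m * x + c}"
    by (auto simp: line_def parabola_def)
  then show ?thesis
    by (simp add: card_image inj_on_def)
qed

text \<open>\<open>D\<close> is the discriminant of \<open>p^2 * x^2 - m * x - c\<close>. Its roots
  lie \<open>sqrt D / p^2\<close> apart, and inserting this distance into the segment area gives the
  formula. Both halves of the theorem thus become statements about \<open>D\<close>.\<close>

lemma cuts_off_area_iff:
  fixes p m c A :: real
  assumes p: "p \<noteq> 0"
  defines "D \<equiv> m\<^sup>2 + 4 * p\<^sup>2 * c"
  shows "cuts_off_area p m c A \<longleftrightarrow> D > 0 \<and> A = sqrt D ^ 3 / (6 * p ^ 4)"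
proof -
  have complete_square: "p\<^sup>2 * x\<^sup>2 = m * x + c \<longleftrightarrow> (2 * p\<^sup>2 * x - m)\<^sup>2 = D" for x
  proof -
    have "(2 * p\<^sup>2 * x - m)\<^sup>2 - D = 4 * p\<^sup>2 * (p\<^sup>2 * x\<^sup>2 - (m * x + c))"
      unfolding D_def by (simp add: algebra_simps power2_eq_square)
    then show ?thesis
      using p by (metis diff_eq_diff_eq eq_iff_diff_eq_0 mult_eq_0_iff power_not_zero zero_neq_numeral)
  qed
  show ?thesis
  proof (cases "D > 0")
    case True
    define r s where "r = (m - sqrt D) / (2 * p\<^sup>2)" and "s = (m + sqrt D) / (2 * p\<^sup>2)"
    have diff: "s - r = sqrt D / p\<^sup>2"
      unfolding r_def s_def using p by (simp add: field_simps)
    have "r < s"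
      using diff True p by (metis diff_gt_0_iff_gt divide_pos_pos real_sqrt_gt_zero zero_less_power2)
    have root_iff: "p\<^sup>2 * x\<^sup>2 = m * x + c \<longleftrightarrow> x = r \<or> x = s" for x
    proof -
      have "(2 * p\<^sup>2 * x - m)\<^sup>2 = D \<longleftrightarrow> 2 * p\<^sup>2 * x - m = sqrt D \<or> 2 * p\<^sup>2 * x - m = - sqrt D"
        using True by (metis power2_eq_iff real_sqrt_pow2 less_imp_le)
      also have "\<dots> \<longleftrightarrow> x = r \<or> x = s"
        unfolding r_def s_def using p by (auto simp: field_simps)
      finally show ?thesis
        by (simp add: complete_square)
    qed
    have "{x. p\<^sup>2 * x\<^sup>2 = m * x + c} = {r, s}"
      using root_iff by auto
    then have card: "card (line m c \<inter> parabola p) = 2"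
      using \<open>r < s\<close> by (simp add: card_line_Int_parabola)
    have m: "p\<^sup>2 * (r + s) = m"
      unfolding r_def s_def using p by (simp add: field_simps)
    \<comment> \<open>That \<open>r\<close> is a root, with \<open>m\<close> already expressed by
      \<open>r + s\<close>, yields the product of the roots.\<close>
    have "p\<^sup>2 * r\<^sup>2 = p\<^sup>2 * (r + s) * r + c"
      using root_iff[of r] m by simp
    then have c: "- p\<^sup>2 * r * s = c"
      by (simp add: algebra_simps power2_eq_square)
    have "measure lborel (segment p m c) = p\<^sup>2 * (s - r) ^ 3 / 6"
      using measure_segment[of r s p] \<open>r < s\<close> unfolding m c by simp
    also have "\<dots> = sqrt D ^ 3 / (6 * p ^ 4)"
      unfolding diff using p by (simp add: field_simps power2_eq_square eval_nat_numeral)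
    finally show ?thesis
      using True card unfolding cuts_off_area_def by auto
  next
    case False
    \<comment> \<open>For \<open>D \<le> 0\<close> the completed square must vanish, which leaves at
      most one intersection point.\<close>
    have "x = m / (2 * p\<^sup>2)" if "p\<^sup>2 * x\<^sup>2 = m * x + c" for x
    proof -
      have "(2 * p\<^sup>2 * x - m)\<^sup>2 \<le> 0"
        using that False complete_square by simp
      then show ?thesis
        using p by (simp add: field_simps)
    qed
    then have "{x. p\<^sup>2 * x\<^sup>2 = m * x + c} \<subseteq> {m / (2 * p\<^sup>2)}"
      by auto
    then have "card {x. p\<^sup>2 * x\<^sup>2 = m * x + c} \<le> 1"
      using card_mono[of "{m / (2 * p\<^sup>2)}"] by fastforce
    then show ?thesis
      using False unfolding cuts_off_area_def card_line_Int_parabola by auto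
  qed
qed

text \<open>Such a \<open>g\<close> is concave and lies below all its tangents. A tangent of nonzero
  slope falls below any bound \<open>b\<close> on one side.\<close>

lemma antimono_derivative_bounded_below_imp_zero:
  fixes g u :: "real \<Rightarrow> real"
  assumes g: "\<And>x. (g has_real_derivative u x) (at x)"
    and u: "antimono u"
    and lower: "\<And>x. b \<le> g x"
  shows "u x = 0"
proof (rule ccontr)
  have below_tangent: "g y \<le> g x + u x * (y - x)" for y
  proof (cases y x rule: linorder_cases)
    case less
    then obtain t where "t < x" "g x - g y = (x - y) * u t"
      using MVT2[of y x g u] g by auto
    moreover have "(x - y) * u x \<le> (x - y) * u t"
      using less \<open>t < x\<close> antimonoD[OF u, of t x] by (intro mult_left_mono) auto
    ultimately show ?thesis
      by (simp add: algebra_simps)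
  next
    case greater
    then obtain t where "x < t" "g y - g x = (y - x) * u t"
      using MVT2[of x y g u] g by auto
    moreover have "(y - x) * u t \<le> (y - x) * u x"
      using greater \<open>x < t\<close> antimonoD[OF u, of x t] by (intro mult_left_mono) auto
    ultimately show ?thesis
      by (simp add: algebra_simps)
  qed simp
  assume "u x \<noteq> 0"
  \<comment> \<open>The chosen abscissa is where the tangent at \<open>x\<close> takes the value
    \<open>b - 1\<close>.\<close>
  then have "g x + u x * ((x + (b - 1 - g x) / u x) - x) = b - 1"
    by simp
  then show False
    using below_tangent[of "x + (b - 1 - g x) / u x"] lower[of "x + (b - 1 - g x) / u x"] by linarith
qed

text \<open>Applied with \<open>q = p^2\<close> and \<open>g = f - p^2 x^2\<close>. The factors
  \<open>u\<close> and \<open>v + 2 * q\<close> may vanish at different points, and \<open>v\<close>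
  has no known sign where \<open>u = 0\<close>. The cube of \<open>u\<close> avoids gluing the
  cases: its derivative has the same sign everywhere.\<close>

lemma clairaut_bounded_below_imp_constant:
  fixes g u v :: "real \<Rightarrow> real"
  assumes g: "\<And>x. (g has_real_derivative u x) (at x)"
    and u: "\<And>x. (u has_real_derivative v x) (at x)"
    and eq: "\<And>x. (u x)\<^sup>2 + 4 * q * g x = D"
    and q: "q \<ge> 0"
    and lower: "\<And>x. b \<le> g x"
  shows "4 * q * g x = D"
proof -
  have uv: "u x * (v x + 2 * q) = 0" for x
  proof -
    have "((\<lambda>x. (u x)\<^sup>2 + 4 * q * g x) has_real_derivative 2 * u x * v x + 4 * q * u x) (at x)"
      by (auto intro!: derivative_eq_intros g u)
    then have "((\<lambda>x. D) has_real_derivative 2 * u x * v x + 4 * q * u x) (at x)"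
      by (simp add: eq)
    then have "2 * u x * v x + 4 * q * u x = 0"
      using DERIV_const DERIV_unique by blast
    then show ?thesis
      by (simp add: algebra_simps)
  qed
  have cube_deriv: "((\<lambda>x. u x ^ 3) has_real_derivative - (6 * q * (u x)\<^sup>2)) (at x)" for x
  proof -
    have "3 * (u x)\<^sup>2 * v x = 3 * u x * (u x * (v x + 2 * q)) - 6 * q * (u x)\<^sup>2"
      by (simp add: algebra_simps power2_eq_square)
    also have "\<dots> = - (6 * q * (u x)\<^sup>2)"
      by (simp only: uv mult_zero_right diff_0)
    finally have "3 * (u x)\<^sup>2 * v x = - (6 * q * (u x)\<^sup>2)" .
    moreover have "((\<lambda>x. u x ^ 3) has_real_derivative 3 * (u x)\<^sup>2 * v x) (at x)"
      by (auto intro!: derivative_eq_intros u)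
    ultimately show ?thesis
      by (simp only:)
  qed
  have "antimono u"
  proof (rule antimonoI)
    fix x y :: real
    assume "x \<le> y"
    then have "u y ^ 3 \<le> u x ^ 3"
      by (rule DERIV_nonpos_imp_nonincreasing) (rule exI conjI cube_deriv | simp add: q)+
    \<comment> \<open>The real cube root is increasing, so monotonicity passes from
      \<open>u ^ 3\<close> back to \<open>u\<close>.\<close>
    then show "u y \<le> u x"
      by (metis odd_numeral odd_real_root_power_cancel real_root_le_iff zero_less_numeral)
  qed
  then have "u x = 0"
    using antimono_derivative_bounded_below_imp_zero g lower by blast
  then show ?thesis
    using eq[of x] by simp
qed

theorem theorem1:
  fixes p :: real
  shows
    "(\<forall>k::real. p * k > 0 \<longrightarrow>
        (\<forall>a m c. tangent_at (\<lambda>x. p\<^sup>2 * x\<^sup>2 + k\<^sup>2) a m c \<longrightarrow>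
           cuts_off_area p m c (4 / 3 * (k ^ 3 / p)))) \<and>
     (\<forall>(f :: real \<Rightarrow> real) (A :: real). p \<noteq> 0 \<longrightarrow> C2 f \<longrightarrow> (\<forall>x. f x > p\<^sup>2 * x\<^sup>2) \<longrightarrow>
        (\<forall>a m c. tangent_at f a m c \<longrightarrow> cuts_off_area p m c A) \<longrightarrow>
        (\<forall>x. f x = p\<^sup>2 * x\<^sup>2 + (root 3 (3 * p * A / 4))\<^sup>2))"
proof (intro conjI allI impI)
  fix k a m c :: real
  assume pk: "p * k > 0" and tangent: "tangent_at (\<lambda>x. p\<^sup>2 * x\<^sup>2 + k\<^sup>2) a m c"
  have "((\<lambda>x. p\<^sup>2 * x\<^sup>2 + k\<^sup>2) has_real_derivative 2 * p\<^sup>2 * a) (at a)"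
    by (auto intro!: derivative_eq_intros)
  then have m: "m = 2 * p\<^sup>2 * a"
    using tangent DERIV_unique unfolding tangent_at_def by blast
  have c: "c = p\<^sup>2 * a\<^sup>2 + k\<^sup>2 - m * a"
    using tangent unfolding tangent_at_def line_def by simp
  \<comment> \<open>The point of tangency \<open>a\<close> cancels, so the area is constant;
    \<open>p * k > 0\<close> later makes the square root \<open>2 * (p * k)\<close>.\<close>
  have D: "m\<^sup>2 + 4 * p\<^sup>2 * c = (2 * (p * k))\<^sup>2"
    unfolding c m by (simp add: algebra_simps power2_eq_square)
  have "p \<noteq> 0" and "k \<noteq> 0"
    using pk by auto
  have "4 / 3 * (k ^ 3 / p) = (2 * (p * k)) ^ 3 / (6 * p ^ 4)"
    using \<open>p \<noteq> 0\<close> by (simp add: field_simps eval_nat_numeral)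
  then show "cuts_off_area p m c (4 / 3 * (k ^ 3 / p))"
    using pk \<open>p \<noteq> 0\<close> \<open>k \<noteq> 0\<close> unfolding cuts_off_area_iff[OF \<open>p \<noteq> 0\<close>] D real_sqrt_abs by simp
next
  fix f :: "real \<Rightarrow> real" and A x :: real
  assume p: "p \<noteq> 0" and C2: "C2 f" and above: "\<forall>x. f x > p\<^sup>2 * x\<^sup>2"
    and area: "\<forall>a m c. tangent_at f a m c \<longrightarrow> cuts_off_area p m c A"
  obtain f' f'' where f': "\<And>x. (f has_real_derivative f' x) (at x)"
    and f'': "\<And>x. (f' has_real_derivative f'' x) (at x)"
    using C2 unfolding C2_def by blast
  \<comment> \<open>The value that \<open>A = sqrt D ^ 3 / (6 * p ^ 4)\<close> forces on
    \<open>sqrt D\<close>, expressed by \<open>A\<close> alone and hence the same for all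
    tangents.\<close>
  define d where "d = root 3 (6 * p ^ 4 * A)"
  have disc: "(f' x)\<^sup>2 + 4 * p\<^sup>2 * (f x - f' x * x) = d\<^sup>2" for x
  proof -
    let ?D = "(f' x)\<^sup>2 + 4 * p\<^sup>2 * (f x - f' x * x)"
    have "tangent_at f x (f' x) (f x - f' x * x)"
      using f' by (simp add: tangent_at_def line_def)
    then have "?D > 0" and "A = sqrt ?D ^ 3 / (6 * p ^ 4)"
      using area cuts_off_area_iff[OF p] by blast+
    then have "sqrt ?D ^ 3 = 6 * p ^ 4 * A"
      using p by simp
    then have "d = sqrt ?D"
      unfolding d_def by (metis odd_real_root_power_cancel odd_numeral)
    then show ?thesis
      using \<open>?D > 0\<close> by simp
  qed
  have "4 * p\<^sup>2 * (f x - p\<^sup>2 * x\<^sup>2) = d\<^sup>2"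
  proof (rule clairaut_bounded_below_imp_constant[where b = 0 and g = "\<lambda>x. f x - p\<^sup>2 * x\<^sup>2"])
    show "((\<lambda>x. f x - p\<^sup>2 * x\<^sup>2) has_real_derivative f' x - 2 * p\<^sup>2 * x) (at x)" for x
      by (auto intro!: derivative_eq_intros f')
    show "((\<lambda>x. f' x - 2 * p\<^sup>2 * x) has_real_derivative f'' x - 2 * p\<^sup>2) (at x)" for x
      by (auto intro!: derivative_eq_intros f'')
    \<comment> \<open>Subtracting the parabola removes the explicit \<open>x\<close> from the
      discriminant equation: the terms \<open>4 * p^4 * x^2\<close> cancel.\<close>
    show "(f' x - 2 * p\<^sup>2 * x)\<^sup>2 + 4 * p\<^sup>2 * (f x - p\<^sup>2 * x\<^sup>2) = d\<^sup>2" for x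
      unfolding disc[of x, symmetric] by (simp add: algebra_simps power2_eq_square)
  qed (use above in \<open>auto intro: less_imp_le\<close>)
  then have "f x = p\<^sup>2 * x\<^sup>2 + (d / (2 * p))\<^sup>2"
    using p by (simp add: field_simps power2_eq_square)
  \<comment> \<open>As in the direct part, \<open>d = 2 * p * k\<close>. Uniqueness of odd roots
    covers negative \<open>p\<close> as well.\<close>
  moreover have "root 3 (3 * p * A / 4) = d / (2 * p)"
  proof (rule odd_real_root_unique)
    have "d ^ 3 = 6 * p ^ 4 * A"
      unfolding d_def by (simp add: odd_real_root_pow)
    then show "(d / (2 * p)) ^ 3 = 3 * p * A / 4"
      using p by (simp add: power_divide field_simps eval_nat_numeral)
  qed simp
  ultimately show "f x = p\<^sup>2 * x\<^sup>2 + (root 3 (3 * p * A / 4))\<^sup>2"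
    by simp
qed

end
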